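(* There are R-IFSs whose minimal invariant sets are not invariant sets of any IFS consisting of Banach contractions. That is, there exist $d\ge1$ and an R-IFS $\{R_1,\dots,R_m,f_1,\dots,f_n\}$ ($m,n>0$) on $\mathbb{R}^d$ with minimal invariant set $X_0$ such that for no finite family $\{h_1,\dots,h_k\}$ of Banach contractions $h_i:\mathbb{R}^d\to\mathbb{R}^d$ does $X_0=\bigcup_{i=1}^k h_i(X_0)$ hold.
   Context: $\mathbb{R}^d$ carries the Euclidean norm. A map $f$ on a metric space $(X,\rho)$ is a (Banach) contraction if there is $\alpha\in[0,1)$ with $\rho(f(x),f(y))\le\alpha\,\rho(x,y)$ for all $x,y$; it is isometric if $\rho(f(x),f(y))=\rho(x,y)$ for all $x,y$. An iterated function system (IFS) on $X$ is a finite family of contraction self-maps of $X$. An R-IFS on $\mathbb{R}^d$ is a function system $\{R_1,\dots,R_m,f_1,\dots,f_n\}$ with $m,n>0$, where each $R_i:\mathbb{R}^d\to\mathbb{R}^d$ is an isometric mapping with $R_i(0)=0$ and each $f_j:\mathbb{R}^d\to\mathbb{R}^d$ is a contraction. An invariant set of a finite system $\mathcal{F}$ of continuous self-maps of $X$ is a nonempty closed set $A\subset X$ with $\bigcup_{f\in\mathcal{F}} f(A)=A$. The minimal invariant set of $\mathcal{F}$ is the invariant set of $\mathcal{F}$ contained in every invariant set of $\mathcal{F}$ (for an R-IFS on $\mathbb{R}^d$ it exists, and it is clearly unique). *)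

theory Defs
  imports "HOL-Analysis.Analysis"
begin

text \<open>The dimension is a bound variable of the theorem, so the d-dimensional Euclidean space is not
  taken as a type but on the carrier of \<^const>\<open>Euclidean_space\<close>: the sequences that vanish
  from index \<open>d\<close> on.\<close>

definition rn_metric :: "nat \<Rightarrow> (nat \<Rightarrow> real) metric" where
  "rn_metric d = metric (topspace (Euclidean_space d), \<lambda>x y. L2_set (\<lambda>i. x i - y i) {..<d})"

lemma Metric_space_rn:
  "Metric_space (topspace (Euclidean_space d)) (\<lambda>x y. L2_set (\<lambda>i. x i - y i) {..<d})"
proof
  fix x y :: "nat \<Rightarrow> real"
  show "0 \<le> L2_set (\<lambda>i. x i - y i) {..<d}"
    by simp
  show "L2_set (\<lambda>i. x i - y i) {..<d} = L2_set (\<lambda>i. y i - x i) {..<d}"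
    by (simp add: L2_set_def power2_commute)
next
  fix x y :: "nat \<Rightarrow> real"
  assume "x \<in> topspace (Euclidean_space d)" "y \<in> topspace (Euclidean_space d)"
  then have "\<forall>i\<ge>d. x i = y i"
    by (simp add: topspace_Euclidean_space)
  then show "L2_set (\<lambda>i. x i - y i) {..<d} = 0 \<longleftrightarrow> x = y"
    by (auto simp: L2_set_eq_0_iff fun_eq_iff) (metis lessThan_iff not_less)
next
  fix x y z :: "nat \<Rightarrow> real"
  show "L2_set (\<lambda>i. x i - z i) {..<d}
      \<le> L2_set (\<lambda>i. x i - y i) {..<d} + L2_set (\<lambda>i. y i - z i) {..<d}"
    using L2_set_triangle_ineq[of "\<lambda>i. x i - y i" "\<lambda>i. y i - z i" "{..<d}"] by simp
qed

lemma mspace_rn_metric: "mspace (rn_metric d) = topspace (Euclidean_space d)"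
  by (simp add: rn_metric_def Metric_space.mspace_metric[OF Metric_space_rn])

lemma mdist_rn_metric: "mdist (rn_metric d) x y = L2_set (\<lambda>i. x i - y i) {..<d}"
  by (simp add: rn_metric_def Metric_space.mdist_metric[OF Metric_space_rn])

lemma mtopology_of_rn_metric: "mtopology_of (rn_metric d) = Euclidean_space d"
proof -
  interpret M: Metric_space "topspace (Euclidean_space d)" "\<lambda>x y. L2_set (\<lambda>i. x i - y i) {..<d}"
    by (rule Metric_space_rn)
  have E: "Euclidean_space d = top_of_set (topspace (Euclidean_space d))"
    unfolding Euclidean_space_def by (simp add: euclidean_product_topology)
  have "openin M.mtopology S \<longleftrightarrow> openin (Euclidean_space d) S" for S
  proof
    assume S: "openin M.mtopology S"
    show "openin (Euclidean_space d) S"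
    proof (subst openin_subopen, intro ballI)
      fix x assume "x \<in> S"
      then obtain e where e: "e > 0" "M.mball x e \<subseteq> S" and x: "x \<in> topspace (Euclidean_space d)"
        using S unfolding M.openin_mtopology by blast
      have cont: "continuous_on UNIV (\<lambda>y. L2_set (\<lambda>i. x i - y i) {..<d})"
        unfolding L2_set_def by (intro continuous_intros continuous_on_product_coordinates)
      have "open {y. L2_set (\<lambda>i. x i - y i) {..<d} < e}"
        by (rule open_Collect_less[OF cont continuous_on_const])
      then have "openin (Euclidean_space d) (M.mball x e)"
        using x by (subst E) (auto simp: openin_open M.mball_def)
      then show "\<exists>T. openin (Euclidean_space d) T \<and> x \<in> T \<and> T \<subseteq> S"
        using e x by auto
    qed
  next
    assume S: "openin (Euclidean_space d) S"
    have "continuous_map M.mtopology euclideanreal (\<lambda>x. x i)" if "i < d" for i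
      unfolding mtopology_is_euclidean[symmetric]
        M.metric_continuous_map[OF Met_TC.Metric_space_axioms]
    proof (intro conjI ballI allI impI)
      fix a e :: real and x :: "nat \<Rightarrow> real"
      assume "0 < (e::real)"
      moreover have "dist (x i) (y i) \<le> L2_set (\<lambda>i. x i - y i) {..<d}" for y
        using member_le_L2_set[of "{..<d}" i "\<lambda>i. \<bar>x i - y i\<bar>"] that
        by (simp add: dist_real_def L2_set_def)
      ultimately show "\<exists>\<delta>>0. \<forall>y. y \<in> topspace (Euclidean_space d)
          \<and> L2_set (\<lambda>i. x i - y i) {..<d} < \<delta> \<longrightarrow> dist (x i) (y i) < e"
        by (meson le_less_trans)
    qed auto
    then have "continuous_map M.mtopology (Euclidean_space d) (\<lambda>x i. if i < d then x i else 0)"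
      by (simp add: continuous_map_componentwise_Euclidean_space)
    then have "continuous_map M.mtopology (Euclidean_space d) (\<lambda>x. x)"
      proof (rule continuous_map_eq)
      fix x assume "x \<in> topspace M.mtopology"
      then have "\<forall>i\<ge>d. x i = 0"
        unfolding M.topspace_mtopology by (simp add: topspace_Euclidean_space)
      then show "(\<lambda>i. if i < d then x i else 0) = x"
        by (auto simp: fun_eq_iff)
    qed
    then have "openin M.mtopology {x \<in> topspace M.mtopology. x \<in> S}"
      using S by (rule openin_continuous_map_preimage)
    moreover have "{x \<in> topspace M.mtopology. x \<in> S} = S"
      using openin_subset[OF S] by auto
    ultimately show "openin M.mtopology S"
      by simp
  qed
  then show ?thesis
    by (simp add: rn_metric_def topology_eq)
qed

definition banach_contraction :: "'a metric \<Rightarrow> ('a \<Rightarrow> 'a) \<Rightarrow> bool" where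
  "banach_contraction X f \<longleftrightarrow>
     f \<in> mspace X \<rightarrow> mspace X \<and>
     (\<exists>\<alpha>. 0 \<le> \<alpha> \<and> \<alpha> < 1 \<and>
        (\<forall>x\<in>mspace X. \<forall>y\<in>mspace X. mdist X (f x) (f y) \<le> \<alpha> * mdist X x y))"

definition isometric_self_map :: "'a metric \<Rightarrow> ('a \<Rightarrow> 'a) \<Rightarrow> bool" where
  "isometric_self_map X f \<longleftrightarrow>
     f \<in> mspace X \<rightarrow> mspace X \<and>
     (\<forall>x\<in>mspace X. \<forall>y\<in>mspace X. mdist X (f x) (f y) = mdist X x y)"

definition IFS :: "'a metric \<Rightarrow> ('a \<Rightarrow> 'a) set \<Rightarrow> bool" where
  "IFS X H \<longleftrightarrow> finite H \<and> (\<forall>h\<in>H. banach_contraction X h)"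

definition R_IFS ::
  "nat \<Rightarrow> nat \<Rightarrow> (nat \<Rightarrow> (nat \<Rightarrow> real) \<Rightarrow> nat \<Rightarrow> real) \<Rightarrow>
   nat \<Rightarrow> (nat \<Rightarrow> (nat \<Rightarrow> real) \<Rightarrow> nat \<Rightarrow> real) \<Rightarrow> bool" where
  "R_IFS d m R n f \<longleftrightarrow>
     m > 0 \<and> n > 0 \<and>
     (\<forall>i\<in>{1..m}. isometric_self_map (rn_metric d) (R i) \<and> R i (\<lambda>_. 0) = (\<lambda>_. 0)) \<and>
     (\<forall>j\<in>{1..n}. banach_contraction (rn_metric d) (f j))"

definition invariant_set :: "'a metric \<Rightarrow> ('a \<Rightarrow> 'a) set \<Rightarrow> 'a set \<Rightarrow> bool" where
  "invariant_set X F A \<longleftrightarrow>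
     A \<noteq> {} \<and> closedin (mtopology_of X) A \<and> (\<Union>f\<in>F. f ` A) = A"

definition minimal_invariant_set :: "'a metric \<Rightarrow> ('a \<Rightarrow> 'a) set \<Rightarrow> 'a set \<Rightarrow> bool" where
  "minimal_invariant_set X F A \<longleftrightarrow>
     invariant_set X F A \<and> (\<forall>B. invariant_set X F B \<longrightarrow> A \<subseteq> B)"

end

theory Submission
  imports Defs
begin

text \<open>
  In three-dimensional space, viewed as \<^typ>\<open>complex \<times> real\<close>, the isometry is an irrational
  rotation about the vertical axis, and the minimal invariant set consists of the axis points of
  height \<open>0\<close> and \<open>4\<^sup>-\<^sup>k\<close> together with the horizontal unit circles of height \<open>0\<close> and \<open>w\<^sub>k\<close>,
  where \<open>w\<^sub>k\<close> decreases to \<open>0\<close>. The contractions reproduce the axis points and send the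
  \<open>k\<close>-th one to a point of the \<open>k\<close>-th circle, which the rotation spreads densely over that circle.
  A finite family of contractions cannot replace the rotation: its images of the axis points are
  countable, so every circle must meet the image of a circle, and by connectedness this image lies
  at one height. A contraction fixing the height \<open>0\<close> of the limit circle can only lower the others
  by a definite factor. The sequence \<open>w\<close> contains plateaus on which it is almost constant, and whose
  lengths outgrow any multiple of the number of earlier terms; then the circles above a plateau
  are too few to cover those on it.
\<close>

section \<open>Circle heights with long plateaus, and a 1-Lipschitz function producing them\<close>

text \<open>Constant on each block of indices from \<open>fact n\<close> up to, but excluding,
  \<open>fact (Suc n)\<close>. The ratio \<open>Suc n\<close> of the block ends is unbounded, so a
  plateau can outgrow any fixed multiple of its first index.\<close>

definition stair :: "nat \<Rightarrow> nat" where
  "stair k = fact (LEAST m. k < fact m)"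

text \<open>The power creates the plateaus. The second factor makes the sequence strictly
  decreasing, and as it tends to 1 the plateaus become flat. The division by 8 gives the bound
  \<open>(1/4) ^ (k + 2)\<close>, small against the gaps between the powers of
  \<open>1/4\<close>.\<close>

definition height :: "nat \<Rightarrow> real" where
  "height k = (1/4) ^ stair k * (1 + 1 / real (Suc k)) / 8"

lemma stair_gt: "k < stair k"
proof -
  have "k < fact (Suc k)"
    using fact_ge_self[of "Suc k"] by linarith
  then show ?thesis
    unfolding stair_def by (rule LeastI)
qed

lemma stair_mono: "stair k \<le> stair (Suc k)"
proof -
  have "Suc k < fact (LEAST m. Suc k < fact m)"
    using stair_gt[of "Suc k"] by (simp add: stair_def)
  then have "(LEAST m. k < fact m) \<le> (LEAST m. Suc k < fact m)"
    by (intro Least_le) simp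
  then show ?thesis
    unfolding stair_def by (rule fact_mono)
qed

lemma stair_eq:
  assumes "fact n \<le> k" "k < fact (Suc n)"
  shows "stair k = fact (Suc n)"
proof -
  have "(LEAST m. k < fact m) = Suc n"
  proof (rule Least_equality)
    fix m assume "k < fact m"
    then have "fact n < (fact m :: nat)"
      using assms by linarith
    then show "Suc n \<le> m"
      by (meson fact_mono leD not_less_eq_eq)
  qed (use assms in simp)
  then show ?thesis
    by (simp only: stair_def)
qed

lemma height_pos: "0 < height k"
  unfolding height_def by (auto intro!: mult_pos_pos add_pos_nonneg)

lemma height_le: "height k \<le> (1/4) ^ (k + 2)"
proof -
  have "(1/4 :: real) ^ stair k \<le> (1/4) ^ Suc k"
    using stair_gt[of k] by (intro power_decreasing) auto
  moreover have "1 + 1 / real (Suc k) \<le> 2"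
    by simp
  ultimately have "(1/4) ^ stair k * (1 + 1 / real (Suc k)) \<le> (1/4) ^ Suc k * 2"
    by (intro mult_mono) auto
  then show ?thesis
    unfolding height_def by (simp add: mult_ac)
qed

lemma height_Suc_less: "height (Suc k) < height k"
proof -
  have "(1/4 :: real) ^ stair (Suc k) \<le> (1/4) ^ stair k"
    using stair_mono by (intro power_decreasing) auto
  moreover have "1 + 1 / real (Suc (Suc k)) < 1 + 1 / real (Suc k)"
    by (simp add: frac_less2)
  ultimately have "(1/4) ^ stair (Suc k) * (1 + 1 / real (Suc (Suc k)))
      < (1/4) ^ stair k * (1 + 1 / real (Suc k))"
    by (intro mult_le_less_imp_less) auto
  then show ?thesis
    by (simp add: height_def)
qed

lemma height_strict_antimono: "k < l \<Longrightarrow> height l < height k"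
  by (rule lift_Suc_mono_less[of "\<lambda>k. - height k", simplified]) (rule height_Suc_less)

lemma height_less_iff: "height k < height l \<longleftrightarrow> l < k"
  by (metis height_strict_antimono linorder_neqE_nat order_less_asym order_less_irrefl)

lemma height_eq_iff: "height k = height l \<longleftrightarrow> k = l"
  by (metis height_strict_antimono linorder_neqE_nat order_less_irrefl)

lemma height_le_iff: "height k \<le> height l \<longleftrightarrow> l \<le> k"
  by (metis height_less_iff leD leI)

lemma height_tendsto_0: "height \<longlonglongrightarrow> 0"
proof (rule real_tendsto_sandwich[where f = "\<lambda>_. 0" and h = "\<lambda>k. (1/4) ^ (k + 2)"])
  show "(\<lambda>k. (1/4) ^ (k + 2)) \<longlonglongrightarrow> (0::real)"
    by (intro LIMSEQ_ignore_initial_segment LIMSEQ_realpow_zero) auto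
  show "\<forall>\<^sub>F k in sequentially. height k \<le> (1/4) ^ (k + 2)"
    by (intro always_eventually allI height_le)
  show "\<forall>\<^sub>F k in sequentially. 0 \<le> height k"
    by (intro always_eventually allI less_imp_le height_pos)
qed (rule tendsto_const)

text \<open>Within one block of \<open>stair\<close> two heights differ only in the factor
  \<open>1 + 1 / real (Suc k)\<close>, which is so close to 1 for large indices that multiplying by
  \<alpha> outweighs it.\<close>

lemma height_plateau:
  assumes "\<alpha> < 1" "0 < \<epsilon>"
  obtains L where "height L < \<epsilon>" "\<alpha> * height L < height (Suc M * L)"
proof -
  have "(\<lambda>k. \<alpha> * (1 + 1 / real (Suc k))) \<longlonglongrightarrow> \<alpha> * (1 + 0)"
    by (intro tendsto_intros LIMSEQ_Suc lim_1_over_n)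
  then have "\<forall>\<^sub>F k in sequentially. \<alpha> * (1 + 1 / real (Suc k)) < 1"
    using \<open>\<alpha> < 1\<close> by (intro order_tendstoD(2)[where a = 1]) auto
  moreover have "\<forall>\<^sub>F k in sequentially. height k < \<epsilon>"
    using height_tendsto_0 \<open>0 < \<epsilon>\<close> by (rule order_tendstoD(2))
  ultimately have "\<forall>\<^sub>F k in sequentially. \<alpha> * (1 + 1 / real (Suc k)) < 1 \<and> height k < \<epsilon>"
    by (rule eventually_conj)
  then obtain N where N: "\<And>k. N \<le> k \<Longrightarrow> \<alpha> * (1 + 1 / real (Suc k)) < 1 \<and> height k < \<epsilon>"
    unfolding eventually_sequentially by blast
  \<comment> \<open>From \<open>n > M\<close> follows
    \<open>Suc M * fact n < Suc n * fact n = fact (Suc n)\<close>, which keeps both indices in one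
    block; \<open>n \<ge> N\<close> makes the estimates valid at \<open>fact n\<close>.\<close>
  define n where "n = max N (Suc M)"
  define L :: nat where "L = fact n"
  have L: "N \<le> L" "0 < L"
    using fact_ge_self[of n] by (auto simp: L_def n_def)
  have "Suc M * L < fact (Suc n)"
    by (auto simp: L_def n_def)
  moreover have "L \<le> Suc M * L"
    by simp
  ultimately have st: "stair L = fact (Suc n)" "stair (Suc M * L) = fact (Suc n)"
    unfolding L_def by (intro stair_eq; simp)+
  define c :: real where "c = (1/4) ^ fact (Suc n) / 8"
  have "0 < c"
    by (simp add: c_def)
  have "\<alpha> * height L = c * (\<alpha> * (1 + 1 / real (Suc L)))"
    unfolding height_def st c_def by simp
  also have "\<dots> < c * 1"
    using N[OF L(1)] \<open>0 < c\<close> by (intro mult_strict_left_mono) auto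
  also have "\<dots> \<le> c * (1 + 1 / real (Suc (Suc M * L)))"
    using \<open>0 < c\<close> by (intro mult_left_mono) auto
  also have "\<dots> = height (Suc M * L)"
    unfolding height_def st c_def by simp
  finally show thesis
    using N[OF L(1)] that by blast
qed

text \<open>The set is chosen so that its distance from \<open>4\<^sup>-\<^sup>k\<^sup>-\<^sup>1\<close> is \<^term>\<open>height k\<close>; using a distance
  function makes the interpolation 1-Lipschitz for free.\<close>

definition profile :: "real \<Rightarrow> real" where
  "profile s = infdist s (range (\<lambda>k. (1/4) ^ Suc k + height k))"

lemma profile_diff_le: "\<bar>profile s - profile t\<bar> \<le> \<bar>s - t\<bar>"
  using infdist_triangle_abs[of s _ t] by (simp only: profile_def dist_real_def)

text \<open>The \<open>k\<close>-th point of the set is at distance \<open>height k\<close>, which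
  is at most a quarter of \<open>(1/4) ^ Suc k\<close>. No other point is closer: those of smaller
  index lie above \<open>(1/4) ^ k\<close>, those of larger index below
  \<open>5/16 * (1/4) ^ Suc k\<close>.\<close>

lemma profile_power: "profile ((1/4) ^ Suc k) = height k"
proof (rule antisym)
  show "profile ((1/4) ^ Suc k) \<le> height k"
    unfolding profile_def using height_pos[of k]
    by (intro infdist_le2[where a = "(1/4) ^ Suc k + height k"]) (auto simp: dist_real_def)
  have "height k \<le> dist ((1/4) ^ Suc k) ((1/4) ^ Suc j + height j)" for j
  proof (cases j k rule: linorder_cases)
    case less
    then have "(1/4 :: real) ^ k \<le> (1/4) ^ Suc j"
      by (intro power_decreasing) auto
    then show ?thesis
      using height_le[of k] height_pos[of j] zero_le_power[of "1/4::real" k]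
      unfolding dist_real_def power_Suc power_add power2_eq_square by simp
  next
    case equal
    then show ?thesis
      by (simp add: dist_real_def)
  next
    case greater
    then have "(1/4 :: real) ^ j \<le> (1/4) ^ Suc k"
      by (intro power_decreasing) auto
    then show ?thesis
      using height_le[of k] height_le[of j] zero_le_power[of "1/4::real" k]
      unfolding dist_real_def power_Suc power_add power2_eq_square by simp
  qed
  then show "height k \<le> profile ((1/4) ^ Suc k)"
    unfolding profile_def by (subst infdist_notempty) (auto intro!: cINF_greatest)
qed

lemma profile_0: "profile 0 = 0"
proof -
  have "(\<lambda>k. (1/4) ^ Suc k + height k) \<longlonglongrightarrow> 0 + 0"
    by (intro tendsto_add height_tendsto_0 LIMSEQ_Suc LIMSEQ_realpow_zero) auto
  then have "0 \<in> closure (range (\<lambda>k. (1/4) ^ Suc k + height k))"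
    unfolding closure_sequential add_0
    by (intro exI[of _ "\<lambda>k. (1/4) ^ Suc k + height k"] conjI allI rangeI)
  then show ?thesis
    by (simp add: profile_def flip: in_closure_iff_infdist_zero)
qed

section \<open>The set of axis points and circles\<close>

abbreviation axis_heights :: "real set" where
  "axis_heights \<equiv> insert 0 (range (\<lambda>k. (1/4) ^ k))"

abbreviation circle_heights :: "real set" where
  "circle_heights \<equiv> insert 0 (range height)"

definition rings :: "(complex \<times> real) set" where
  "rings = {0} \<times> axis_heights \<union> sphere 0 1 \<times> circle_heights"

lemma circle_height_bounds: "s \<in> circle_heights \<Longrightarrow> 0 \<le> s \<and> s \<le> 1"
  using height_pos height_le power_le_one[of "1/4::real"]
  by (auto simp: less_imp_le intro: order_trans[OF height_le power_le_one])

lemma compact_rings: "compact rings"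
proof -
  have "compact axis_heights"
    by (intro compact_sequence_with_limit LIMSEQ_realpow_zero) auto
  moreover have "compact circle_heights"
    by (intro compact_sequence_with_limit height_tendsto_0)
  ultimately show ?thesis
    unfolding rings_def by (intro compact_Un compact_Times) auto
qed

lemma snd_rings_nonneg: "p \<in> rings \<Longrightarrow> 0 \<le> snd p"
  by (auto simp: rings_def less_imp_le[OF height_pos])

lemma countable_snd_rings: "countable (snd ` rings)"
proof (rule countable_subset)
  show "snd ` rings \<subseteq> axis_heights \<union> circle_heights"
    by (auto simp: rings_def)
qed auto

lemma uncountable_circle: "uncountable (sphere 0 1 :: complex set)"
proof (rule connected_uncountable)
  show "connected (sphere 0 1 :: complex set)"
    by (rule connected_sphere) simp
  show "1 \<in> sphere (0::complex) 1" "-1 \<in> sphere (0::complex) 1"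
    by (simp_all add: dist_norm)
qed auto

section \<open>The maps of the R-IFS and the invariance of \<open>rings\<close>\<close>

text \<open>A quarter of the height on the upper axis, and zero on the circles because their heights
  do not exceed their radius 1. Maps factoring through \<open>cone\<close> thus see only the axis
  part of \<open>rings\<close>.\<close>

definition cone :: "complex \<times> real \<Rightarrow> real" where
  "cone p = max 0 ((snd p - norm (fst p)) / 4)"

lemma cone_diff_le: "\<bar>cone p - cone q\<bar> \<le> 1/2 * dist p q"
proof -
  have "\<bar>snd p - snd q\<bar> \<le> dist p q"
    using dist_snd_le[of p q] by (simp add: dist_real_def)
  moreover have "\<bar>norm (fst p) - norm (fst q)\<bar> \<le> dist p q"
    using norm_triangle_ineq3[of "fst p" "fst q"] dist_fst_le[of p q] by (simp add: dist_norm)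
  ultimately show ?thesis
    unfolding cone_def max_def by (simp only: split: if_split) argo
qed

lemma cone_axis: "0 \<le> t \<Longrightarrow> cone (0, t) = t / 4"
  by (simp add: cone_def)

lemma cone_circle: "norm u = 1 \<Longrightarrow> s \<in> circle_heights \<Longrightarrow> cone (u, s) = 0"
  using circle_height_bounds[of s] by (simp add: cone_def)

definition shrink :: "complex \<times> real \<Rightarrow> complex \<times> real" where
  "shrink p = (0, cone p)"

text \<open>As \<open>cone\<close> quarters the axis height, the axis point of height
  \<open>(1/4) ^ k\<close> reaches \<open>profile\<close> as \<open>(1/4) ^ Suc k\<close> and lands
  on the circle of height \<open>height k\<close>.\<close>

definition lift :: "complex \<times> real \<Rightarrow> complex \<times> real" where
  "lift p = (1, profile (cone p))"

definition spin :: "real \<Rightarrow> complex \<times> real \<Rightarrow> complex \<times> real" where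
  "spin \<theta> p = (cis (2 * pi * \<theta>) * fst p, snd p)"

lemma lipschitz_shrink: "(1/2)-lipschitz_on UNIV shrink"
  using cone_diff_le by (auto intro!: lipschitz_onI simp: shrink_def dist_Pair_Pair dist_real_def)

lemma lipschitz_lift: "(1/2)-lipschitz_on UNIV lift"
  using order_trans[OF profile_diff_le cone_diff_le]
  by (auto intro!: lipschitz_onI simp: lift_def dist_Pair_Pair dist_real_def)

lemma dist_spin: "dist (spin \<theta> p) (spin \<theta> q) = dist p q"
proof -
  have "dist (cis (2 * pi * \<theta>) * u) (cis (2 * pi * \<theta>) * v) = dist u v" for u v
    by (simp add: dist_norm norm_mult flip: right_diff_distrib)
  then show ?thesis
    by (simp add: spin_def dist_prod_def)
qed

lemma spin_image_rings: "spin \<theta> ` rings = rings"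
proof -
  have rings: "spin \<theta> p \<in> rings" if "p \<in> rings" for \<theta> p
    using that by (auto simp: spin_def rings_def norm_mult)
  have inverse: "spin \<theta> (spin (- \<theta>) p) = p" for p
    by (cases p) (simp add: spin_def cis_mult flip: mult.assoc)
  show ?thesis
  proof (intro equalityI image_subsetI subsetI)
    fix p assume "p \<in> rings"
    then show "p \<in> spin \<theta> ` rings"
      using rings by (intro image_eqI[where x = "spin (- \<theta>) p"]) (auto simp: inverse)
  qed (rule rings)
qed

text \<open>Since \<open>spin \<theta>\<close> alone maps \<open>rings\<close> onto itself, the
  other three maps merely have to stay inside.\<close>

lemma rings_invariant:
  "(\<Union>f\<in>{spin \<theta>, shrink, \<lambda>_. (0, 1), lift}. f ` rings) = rings"
proof -
  \<comment> \<open>On \<open>rings\<close>, \<open>cone\<close> only takes values at which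
    \<open>profile\<close> is known.\<close>
  have sl: "(\<exists>k. cone p = (1/4) ^ Suc k) \<or> cone p = 0" if "p \<in> rings" for p
  proof (cases "fst p = 0")
    case True
    have sl: "cone p = snd p / 4"
      using True cone_axis[of "snd p"] snd_rings_nonneg[OF that] by (cases p) auto
    consider "snd p = 0" | k where "snd p = (1/4) ^ k"
      using \<open>p \<in> rings\<close> True by (auto simp: rings_def)
    then show ?thesis
    proof cases
      case (2 k)
      then have "cone p = (1/4) ^ Suc k"
        using sl by simp
      then show ?thesis
        by blast
    qed (use sl in simp)
  next
    case False
    then show ?thesis
      using that cone_circle by (auto simp: rings_def)
  qed
  have "shrink p \<in> rings" if "p \<in> rings" for p
    using sl[OF that] unfolding shrink_def rings_def by (auto simp del: power_Suc)
  moreover have "lift p \<in> rings" if "p \<in> rings" for p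
    using sl[OF that] profile_0 profile_power unfolding lift_def rings_def by (auto simp del: power_Suc)
  moreover have "(0, 1) \<in> rings"
    unfolding rings_def by (auto intro: image_eqI[where x = 0])
  ultimately show ?thesis
    using spin_image_rings[of \<theta>] by auto
qed

section \<open>Minimality of \<open>rings\<close>\<close>

text \<open>Kronecker's theorem makes the fractional parts of \<open>n * \<theta>\<close> dense in
  the unit interval; the continuous map \<open>\<lambda>y. cis (2 * pi * y)\<close> carries this
  density to the circle.\<close>

lemma circle_subset_closure_cis:
  assumes "\<theta> \<notin> \<rat>"
  shows "sphere 0 1 \<subseteq> closure (range (\<lambda>n::nat. cis (2 * pi * \<theta>) ^ n))"
proof
  fix u :: complex assume "u \<in> sphere 0 1"
  then obtain x where x: "0 \<le> x" "x < 2 * pi" "u = cis x"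
    using Arg2pi[of u] by (auto simp: cis_conv_exp is_Arg_def)
  have per: "cis (2 * pi * frac y) = cis (2 * pi * y)" for y
  proof -
    have "cis (2 * pi * y) = cis (2 * pi * frac y) * cis (2 * pi * of_int \<lfloor>y\<rfloor>)"
      by (simp add: cis_mult frac_def algebra_simps)
    then show ?thesis
      by (simp add: cis_multiple_2pi)
  qed
  have "x / (2 * pi) \<in> closure (range (\<lambda>n. frac (real n * \<theta>)))"
    using x by (simp add: Kronecker_approx_1[OF assms])
  then have "cis (2 * pi * (x / (2 * pi))) \<in> closure ((\<lambda>x. cis (2 * pi * x)) ` range (\<lambda>n. frac (real n * \<theta>)))"
    by (rule subsetD[OF image_closure_subset[OF _ closed_closure closure_subset] imageI, rotated])
      (intro continuous_intros)
  moreover have "cis (2 * pi * (real n * \<theta>)) = cis (2 * pi * \<theta>) ^ n" for n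
    by (simp add: Complex.DeMoivre mult_ac)
  then have "(\<lambda>x. cis (2 * pi * x)) ` range (\<lambda>n. frac (real n * \<theta>))
      = range (\<lambda>n::nat. cis (2 * pi * \<theta>) ^ n)"
    by (simp only: image_image per)
  ultimately show "u \<in> closure (range (\<lambda>n::nat. cis (2 * pi * \<theta>) ^ n))"
    using x by simp
qed

text \<open>The set fills up in stages: the constant map gives the top axis point,
  \<open>shrink\<close> the lower ones, closedness the one at height 0; \<open>lift\<close> then
  gives one point of every circle, and its orbit under \<open>spin \<theta>\<close> is dense
  there.\<close>

lemma rings_minimal:
  assumes "\<theta> \<notin> \<rat>" "closed A" "A \<noteq> {}"
    and sub: "(\<Union>f\<in>{spin \<theta>, shrink, \<lambda>_. (0, 1), lift}. f ` A) \<subseteq> A"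
  shows "rings \<subseteq> A"
proof -
  have cl: "spin \<theta> p \<in> A" "shrink p \<in> A" "(0, 1) \<in> A" "lift p \<in> A" if "p \<in> A" for p
    using sub that by auto
  have axis_k: "(0, (1/4) ^ k) \<in> A" for k
  proof (induction k)
    case 0
    then show ?case
      using cl(3) \<open>A \<noteq> {}\<close> by auto
  next
    case (Suc k)
    then show ?case
      using cl(2)[OF Suc] cone_axis[of "(1/4) ^ k"] by (simp add: shrink_def)
  qed
  have "(\<lambda>k. (0, (1/4) ^ k)) \<longlonglongrightarrow> (0 :: complex, 0 :: real)"
    by (intro tendsto_Pair tendsto_const LIMSEQ_realpow_zero) auto
  then have axis_0: "(0, 0) \<in> A"
    using axis_k by (rule closed_sequentially[OF \<open>closed A\<close>, rotated])
  have one: "(1, s) \<in> A" if "s \<in> circle_heights" for s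
    using that
  proof (elim insertE rangeE)
    fix k assume "s = height k"
    moreover have "cone (0, (1/4) ^ k) = (1/4) ^ Suc k"
      by (simp add: cone_axis)
    ultimately show ?thesis
      using cl(4)[OF axis_k[of k]] by (simp only: lift_def profile_power)
  next
    assume "s = 0"
    then show ?thesis
      using cl(4)[OF axis_0] by (simp add: lift_def cone_axis profile_0)
  qed
  have "(u, s) \<in> A" if "u \<in> sphere 0 1" "s \<in> circle_heights" for u s
  proof -
    have "(cis (2 * pi * \<theta>) ^ n, s) \<in> A" for n
    proof (induction n)
      case 0
      then show ?case
        using one[OF that(2)] by simp
    next
      case (Suc n)
      then show ?case
        using cl(1)[OF Suc] by (simp add: spin_def)
    qed
    moreover have "closed ((\<lambda>u. (u, s)) -` A)"
      using \<open>closed A\<close> by (intro continuous_closed_vimage) (auto intro!: continuous_intros)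
    ultimately have "closure (range (\<lambda>n. cis (2 * pi * \<theta>) ^ n)) \<subseteq> (\<lambda>u. (u, s)) -` A"
      by (intro closure_minimal) auto
    then show ?thesis
      using circle_subset_closure_cis[OF \<open>\<theta> \<notin> \<rat>\<close>] that(1) by blast
  qed
  then show ?thesis
    using axis_k axis_0 by (auto simp: rings_def)
qed

section \<open>No finite family of contractions reproduces \<open>rings\<close>\<close>

text \<open>The heights occurring on the image of a circle form a connected set of reals, which
  would be uncountable if it had two elements, but \<open>rings\<close> has only countably many
  heights.\<close>

lemma snd_constant_on_circle:
  assumes "continuous_on UNIV h" "h ` rings \<subseteq> rings" "s \<in> circle_heights" "norm u = 1"
  shows "snd (h (u, s)) = snd (h (1, s))"
proof -
  let ?S = "(\<lambda>u. snd (h (u, s))) ` sphere 0 1"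
  have "continuous_on (sphere 0 1) (\<lambda>u. snd (h (u, s)))"
    by (intro continuous_intros continuous_on_compose2[OF assms(1)]) auto
  then have "connected ?S"
    by (rule connected_continuous_image) (rule connected_sphere, simp)
  moreover have "h (u, s) \<in> rings" if "u \<in> sphere 0 1" for u
    using assms(3) that by (intro subsetD[OF assms(2) imageI]) (simp add: rings_def)
  then have "?S \<subseteq> snd ` rings"
    by blast
  then have "countable ?S"
    using countable_snd_rings countable_subset by blast
  moreover have "snd (h (u, s)) \<in> ?S" "snd (h (1, s)) \<in> ?S"
    using assms(4) by auto
  ultimately show ?thesis
    using connected_uncountable[of ?S "snd (h (u, s))" "snd (h (1, s))"] by blast
qed

text \<open>Countably many images of axis points cannot exhaust a circle, so some point of it comes
  from a circle. As heights are constant along that source circle, its base point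
  \<open>(1, s)\<close> may represent it.\<close>

lemma circle_source:
  assumes "finite H" "\<And>h. h \<in> H \<Longrightarrow> continuous_on UNIV h" "(\<Union>h\<in>H. h ` rings) = rings"
  obtains h s where "h \<in> H" "s \<in> circle_heights" "snd (h (1, s)) = height k"
proof -
  define A :: "(complex \<times> real) set" where "A = {0} \<times> axis_heights"
  have "countable A"
    unfolding A_def by (intro countable_SIGMA) auto
  then have "countable (\<Union>h\<in>H. h ` A)"
    using \<open>finite H\<close> by (simp add: countable_finite)
  moreover have "uncountable ((\<lambda>u. (u, height k)) ` sphere (0 :: complex) 1)"
    using uncountable_circle by (subst countable_image_inj_eq) (auto intro: inj_onI)
  ultimately have "\<not> (\<lambda>u. (u, height k)) ` sphere (0 :: complex) 1 \<subseteq> (\<Union>h\<in>H. h ` A)"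
    using countable_subset by blast
  then obtain u where u: "u \<in> sphere 0 1" "(u, height k) \<notin> (\<Union>h\<in>H. h ` A)"
    by blast
  then have "(u, height k) \<in> (\<Union>h\<in>H. h ` rings)"
    unfolding assms(3) by (simp add: rings_def)
  then obtain h p where h: "h \<in> H" "p \<in> rings" "h p = (u, height k)"
    by (metis UN_E imageE)
  have "p \<notin> A"
  proof
    assume "p \<in> A"
    then have "h p \<in> (\<Union>h\<in>H. h ` A)"
      using h(1) by blast
    then show False
      using h(3) u(2) by simp
  qed
  then obtain v s where "p = (v, s)" "norm v = 1" "s \<in> circle_heights"
    using h(2) by (auto simp: rings_def A_def)
  moreover have "h ` rings \<subseteq> rings"
    using assms(3) h(1) by blast
  ultimately have "snd (h (1, s)) = height k"
    using snd_constant_on_circle[OF assms(2)[OF h(1)]] h(3) by (metis snd_conv)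
  then show thesis
    using that h(1) \<open>s \<in> circle_heights\<close> by blast
qed

text \<open>Pigeonhole: each height on the plateau would need its own pair of a map in
  \<open>H\<close> and a circle of index below \<open>L\<close>, and there is one pair too
  few.\<close>

lemma rings_not_attractor:
  assumes "finite H" and lip: "\<And>h. h \<in> H \<Longrightarrow> \<exists>\<alpha><1. \<alpha>-lipschitz_on UNIV h"
  shows "(\<Union>h\<in>H. h ` rings) \<noteq> rings"
proof
  assume eq: "(\<Union>h\<in>H. h ` rings) = rings"
  obtain a where a: "\<And>h. h \<in> H \<Longrightarrow> a h < 1 \<and> (a h)-lipschitz_on UNIV h"
    using lip by metis
  \<comment> \<open>A common Lipschitz constant; the inserted 0 covers empty \<open>H\<close> and
    gives \<open>0 \<le> \<alpha>\<close>.\<close>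
  define \<alpha> where "\<alpha> = Max (insert 0 (a ` H))"
  have "\<alpha> < 1" "0 \<le> \<alpha>"
    using \<open>finite H\<close> a by (auto simp: \<alpha>_def)
  have lip_\<alpha>: "\<alpha>-lipschitz_on UNIV h" if "h \<in> H" for h
  proof (rule lipschitz_on_le)
    show "(a h)-lipschitz_on UNIV h" "a h \<le> \<alpha>"
      using a that \<open>finite H\<close> by (auto simp: \<alpha>_def)
  qed
  \<comment> \<open>The height to which \<open>h\<close> sends the limit circle.\<close>
  define \<beta> where "\<beta> h = snd (h (1, 0))" for h :: "complex \<times> real \<Rightarrow> complex \<times> real"
  \<comment> \<open>A positive lower bound for the nonzero values of \<open>\<beta>\<close> on
    \<open>H\<close>; the inserted 1 is the default if there are none.\<close>
  define \<delta> where "\<delta> = Min (insert 1 {b \<in> \<beta> ` H. 0 < b})"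
  have "0 < \<delta>"
    using \<open>finite H\<close> by (auto simp: \<delta>_def)
  have \<delta>: "\<beta> h = 0 \<or> \<delta> \<le> \<beta> h" if "h \<in> H" for h
  proof -
    have "(1, 0) \<in> rings"
      by (simp add: rings_def)
    then have "h (1, 0) \<in> rings"
      using eq that by blast
    then have "0 \<le> \<beta> h"
      by (simp add: \<beta>_def snd_rings_nonneg)
    then show ?thesis
      using that \<open>finite H\<close> by (auto simp: \<delta>_def intro!: Min_le)
  qed
  obtain L where L: "height L < \<delta> / 2" "\<alpha> * height L < height (Suc (card H) * L)"
    using height_plateau[OF \<open>\<alpha> < 1\<close>, of "\<delta> / 2"] \<open>0 < \<delta>\<close> by auto
  let ?src = "\<lambda>(h, l). snd (h (1 :: complex, height l))"
  have "height k \<in> ?src ` (H \<times> {..<L})" if k: "k \<in> {L..Suc (card H) * L}" for k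
  proof -
    have hk: "height k \<le> height L" "height (Suc (card H) * L) \<le> height k"
      using k by (auto simp: height_le_iff)
    obtain h s where h: "h \<in> H" "s \<in> circle_heights" "snd (h (1, s)) = height k"
      using circle_source[OF \<open>finite H\<close> lipschitz_on_continuous_on[OF lip_\<alpha>] eq] by blast
    have "0 \<le> s"
      using circle_height_bounds[OF h(2)] by simp
    have "\<bar>height k - \<beta> h\<bar> \<le> dist (h (1, s)) (h (1, 0))"
      using dist_snd_le[of "h (1, s)" "h (1, 0)"] h(3) by (simp add: dist_real_def \<beta>_def)
    also have "\<dots> \<le> \<alpha> * dist (1 :: complex, s) (1, 0)"
      using lipschitz_onD[OF lip_\<alpha>[OF h(1)]] by simp
    also have "\<dots> = \<alpha> * s"
      using \<open>0 \<le> s\<close> by (simp add: dist_Pair_Pair)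
    finally have le: "\<bar>height k - \<beta> h\<bar> \<le> \<alpha> * s" .
    \<comment> \<open>Either the limit circle stays at height \<open>0\<close> and the plateau is too flat for the factor \<open>\<alpha>\<close>, or
      it moves to height at least \<open>\<delta>\<close>, and only circles far from it come down to the plateau.\<close>
    have "height L < s"
    proof (cases "\<beta> h = 0")
      case True
      then have "\<alpha> * height L < \<alpha> * s"
        using le hk(2) L(2) by linarith
      then show ?thesis
        using \<open>0 \<le> \<alpha>\<close> by (rule mult_left_less_imp_less)
    next
      case False
      then have "\<delta> \<le> \<beta> h"
        using \<delta>[OF h(1)] by simp
      moreover have "\<alpha> * s \<le> 1 * s"
        using \<open>0 \<le> s\<close> \<open>\<alpha> < 1\<close> by (intro mult_right_mono) auto
      ultimately show ?thesis
        using le hk(1) L(1) by linarith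
    qed
    then obtain l where "s = height l" "l < L"
      using h(2) height_pos[of L] by (auto simp: height_less_iff)
    then show ?thesis
      using h by (intro image_eqI[where x = "(h, l)"]) auto
  qed
  then have "height ` {L..Suc (card H) * L} \<subseteq> ?src ` (H \<times> {..<L})"
    by blast
  then have "card (height ` {L..Suc (card H) * L}) \<le> card (?src ` (H \<times> {..<L}))"
    using \<open>finite H\<close> by (intro card_mono) auto
  also have "\<dots> \<le> card (H \<times> {..<L})"
    using \<open>finite H\<close> by (intro card_image_le) auto
  also have "card (height ` {L..Suc (card H) * L}) = card {L..Suc (card H) * L}"
    by (intro card_image inj_onI) (simp add: height_eq_iff)
  \<comment> \<open>The plateau has \<open>Suc (card H) * L - L + 1 = card H * L + 1\<close>
    indices, against \<open>card H * L\<close> pairs.\<close>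
  finally show False
    by (simp add: card_cartesian_product)
qed

section \<open>Transfer to three-dimensional coordinates\<close>

definition coords :: "complex \<times> real \<Rightarrow> nat \<Rightarrow> real" where
  "coords p = (\<lambda>i. if i = 0 then Re (fst p) else if i = 1 then Im (fst p)
                  else if i = 2 then snd p else 0)"

definition uncoords :: "(nat \<Rightarrow> real) \<Rightarrow> complex \<times> real" where
  "uncoords v = (Complex (v 0) (v 1), v 2)"

definition conj_coords ::
  "(complex \<times> real \<Rightarrow> complex \<times> real) \<Rightarrow> (nat \<Rightarrow> real) \<Rightarrow> nat \<Rightarrow> real" where
  "conj_coords f = coords \<circ> f \<circ> uncoords"

lemma uncoords_coords [simp]: "uncoords (coords p) = p"
  by (cases p) (simp add: coords_def uncoords_def complex_eq_iff)

lemma coords_uncoords: "v \<in> mspace (rn_metric 3) \<Longrightarrow> coords (uncoords v) = v"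
  by (auto simp: coords_def uncoords_def mspace_rn_metric topspace_Euclidean_space fun_eq_iff)

lemma coords_in_mspace: "coords p \<in> mspace (rn_metric 3)"
  by (simp add: coords_def mspace_rn_metric topspace_Euclidean_space)

lemma mspace_eq_range_coords: "mspace (rn_metric 3) = range coords"
  using coords_in_mspace coords_uncoords by (metis image_subset_iff rangeI subsetI subset_antisym)

text \<open>The product distance on \<open>complex \<times> real\<close> is again a root of a sum of
  squares, so \<open>coords\<close> is an isometry and Lipschitz constants transfer
  unchanged.\<close>

lemma mdist_coords: "mdist (rn_metric 3) (coords p) (coords q) = dist p q"
proof (cases p; cases q)
  fix u t v s assume "p = (u, t)" "q = (v, s)"
  then show ?thesis
    by (simp add: mdist_rn_metric L2_set_def coords_def lessThan_Suc numeral_3_eq_3 numeral_2_eq_2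
        dist_Pair_Pair dist_real_def dist_complex_def cmod_def add_ac)
qed

text \<open>Both notions of closedness reduce to balls around points outside the set, and
  \<open>coords\<close> matches the balls by \<open>mdist_coords\<close>.\<close>

lemma closedin_coords_iff: "closedin (mtopology_of (rn_metric 3)) (coords ` A) \<longleftrightarrow> closed A"
proof -
  interpret M: Metric_space "mspace (rn_metric 3)" "mdist (rn_metric 3)"
    by simp
  have "inj coords"
    by (rule inj_on_inverseI[of _ uncoords]) simp
  have disj: "disjnt (coords ` A) (M.mball (coords p) r) \<longleftrightarrow> (\<forall>q\<in>A. \<not> dist p q < r)" for p r
  proof -
    have "disjnt (coords ` A) (M.mball (coords p) r) \<longleftrightarrow> (\<forall>q\<in>A. coords q \<notin> M.mball (coords p) r)"
      unfolding disjnt_def by blast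
    then show ?thesis
      by (simp add: coords_in_mspace mdist_coords)
  qed
  have sub: "coords ` A \<subseteq> mspace (rn_metric 3)"
    using coords_in_mspace by blast
  have all: "(\<forall>x. x \<in> mspace (rn_metric 3) - coords ` A \<longrightarrow> P x)
      \<longleftrightarrow> (\<forall>p. p \<notin> A \<longrightarrow> P (coords p))" for P
    unfolding mspace_eq_range_coords using inj_image_mem_iff[OF \<open>inj coords\<close>] by blast
  have "closedin (mtopology_of (rn_metric 3)) (coords ` A)
      \<longleftrightarrow> (\<forall>p. p \<notin> A \<longrightarrow> (\<exists>r>0. \<forall>q\<in>A. \<not> dist p q < r))"
    unfolding mtopology_of_def M.closedin_metric all disj using sub by simp
  also have "\<dots> \<longleftrightarrow> closed A"
    unfolding closed_def open_contains_ball subset_iff mem_ball Compl_iff by blast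
  finally show ?thesis .
qed

lemma invariant_set_conj_coords_iff:
  "invariant_set (rn_metric 3) (conj_coords ` F) (coords ` A)
     \<longleftrightarrow> A \<noteq> {} \<and> closed A \<and> (\<Union>f\<in>F. f ` A) = A"
proof -
  have "(\<Union>g\<in>conj_coords ` F. g ` coords ` A) = coords ` (\<Union>f\<in>F. f ` A)"
    by (auto simp: conj_coords_def image_image)
  moreover have "inj coords"
    by (rule inj_on_inverseI[of _ uncoords]) simp
  ultimately show ?thesis
    by (simp add: invariant_set_def closedin_coords_iff inj_image_eq_iff)
qed

lemma banach_contraction_conj_coords:
  assumes "\<alpha> < 1" "\<alpha>-lipschitz_on UNIV f"
  shows "banach_contraction (rn_metric 3) (conj_coords f)"
  using assms lipschitz_on_nonneg[OF assms(2)] lipschitz_onD[OF assms(2)]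
  unfolding banach_contraction_def
  by (auto simp: conj_coords_def mspace_eq_range_coords mdist_coords intro!: exI[of _ \<alpha>])

lemma banach_contraction_imp_lipschitz:
  assumes "banach_contraction (rn_metric 3) h"
  shows "\<exists>\<alpha><1. \<alpha>-lipschitz_on UNIV (uncoords \<circ> h \<circ> coords)"
proof -
  obtain \<alpha> where h: "h \<in> mspace (rn_metric 3) \<rightarrow> mspace (rn_metric 3)" "0 \<le> \<alpha>" "\<alpha> < 1"
    and le: "\<And>x y. x \<in> mspace (rn_metric 3) \<Longrightarrow> y \<in> mspace (rn_metric 3)
      \<Longrightarrow> mdist (rn_metric 3) (h x) (h y) \<le> \<alpha> * mdist (rn_metric 3) x y"
    using assms unfolding banach_contraction_def by blast
  have "dist (uncoords (h (coords p))) (uncoords (h (coords q))) \<le> \<alpha> * dist p q" for p q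
  proof -
    have "coords (uncoords (h (coords p))) = h (coords p)" for p
      using h(1) coords_in_mspace by (intro coords_uncoords) blast
    then show ?thesis
      using le[OF coords_in_mspace coords_in_mspace, of p q] by (simp flip: mdist_coords)
  qed
  then show ?thesis
    using h by (intro exI[of _ \<alpha>]) (auto intro!: lipschitz_onI)
qed

lemma minimal_invariant_set_rings:
  assumes "\<theta> \<notin> \<rat>"
  shows "minimal_invariant_set (rn_metric 3)
    (conj_coords ` {spin \<theta>, shrink, \<lambda>_. (0, 1), lift}) (coords ` rings)"
  unfolding minimal_invariant_set_def
proof (intro conjI allI impI)
  have "rings \<noteq> {}"
    by (auto simp: rings_def)
  moreover have "closed rings"
    using compact_rings by (rule compact_imp_closed)
  ultimately show "invariant_set (rn_metric 3)
      (conj_coords ` {spin \<theta>, shrink, \<lambda>_. (0, 1), lift}) (coords ` rings)"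
    unfolding invariant_set_conj_coords_iff
    using rings_invariant by (intro conjI)
next
  fix B assume B: "invariant_set (rn_metric 3) (conj_coords ` {spin \<theta>, shrink, \<lambda>_. (0, 1), lift}) B"
  then have "B \<subseteq> range coords"
    unfolding invariant_set_def
    using closedin_subset[of "mtopology_of (rn_metric 3)" B] by (simp add: mspace_eq_range_coords)
  \<comment> \<open>Being inside the carrier, \<open>B\<close> can be pulled back to the model
    space, where \<open>rings_minimal\<close> applies.\<close>
  then obtain A where A: "B = coords ` A"
    by (auto simp: subset_image_iff)
  have inv: "A \<noteq> {} \<and> closed A \<and> (\<Union>f\<in>{spin \<theta>, shrink, \<lambda>_. (0, 1), lift}. f ` A) = A"
    using B unfolding A invariant_set_conj_coords_iff .
  have "rings \<subseteq> A"
    using inv by (elim conjE) (intro rings_minimal[OF assms] equalityD1)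
  then show "coords ` rings \<subseteq> B"
    unfolding A by (rule image_mono)
qed

lemma not_invariant_set_coords_rings:
  assumes "IFS (rn_metric 3) H"
  shows "\<not> invariant_set (rn_metric 3) H (coords ` rings)"
proof
  assume "invariant_set (rn_metric 3) H (coords ` rings)"
  then have "uncoords ` (\<Union>h\<in>H. h ` coords ` rings) = uncoords ` coords ` rings"
    by (simp add: invariant_set_def)
  then have "(\<Union>h\<in>(\<lambda>h. uncoords \<circ> h \<circ> coords) ` H. h ` rings) = rings"
    by (simp add: image_UN image_image)
  moreover have "(\<Union>h\<in>(\<lambda>h. uncoords \<circ> h \<circ> coords) ` H. h ` rings) \<noteq> rings"
  proof (rule rings_not_attractor)
    show "finite ((\<lambda>h. uncoords \<circ> h \<circ> coords) ` H)"
      using assms by (simp add: IFS_def)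
  next
    fix g assume "g \<in> (\<lambda>h. uncoords \<circ> h \<circ> coords) ` H"
    then obtain h where "h \<in> H" "g = uncoords \<circ> h \<circ> coords"
      by blast
    then show "\<exists>\<alpha><1. \<alpha>-lipschitz_on UNIV g"
      using assms banach_contraction_imp_lipschitz[of h] by (simp add: IFS_def)
  qed
  ultimately show False
    by contradiction
qed

section \<open>The counterexample in dimension 3\<close>

theorem proposition1:
  shows "\<exists>d\<ge>1. \<exists>m R n f X0.
     R_IFS d m R n f \<and>
     minimal_invariant_set (rn_metric d) (R ` {1..m} \<union> f ` {1..n}) X0 \<and>
     \<not> (\<exists>H. IFS (rn_metric d) H \<and> invariant_set (rn_metric d) H X0)"
proof -
  have "(\<rat> :: real set) \<noteq> UNIV"
    using countable_rat uncountable_UNIV_real by metis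
  then obtain \<theta> :: real where \<theta>: "\<theta> \<notin> \<rat>"
    by blast
  define R :: "nat \<Rightarrow> (nat \<Rightarrow> real) \<Rightarrow> nat \<Rightarrow> real" where "R i = conj_coords (spin \<theta>)" for i
  \<comment> \<open>The subtraction in \<open>j - 1\<close> turns the indices 1 to 3 of an R-IFS
    into list positions 0 to 2.\<close>
  define f :: "nat \<Rightarrow> (nat \<Rightarrow> real) \<Rightarrow> nat \<Rightarrow> real"
    where "f j = conj_coords ([shrink, \<lambda>_. (0, 1), lift] ! (j - 1))" for j
  have interval: "{1..3} = {1, 2, 3 :: nat}"
    by auto
  have const: "0-lipschitz_on UNIV (\<lambda>_ :: complex \<times> real. (0 :: complex, 1 :: real))"
    by (intro lipschitz_onI) auto
  have coords_0: "coords (0, 0) = (\<lambda>_. 0)"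
    by (auto simp: coords_def)
  have "isometric_self_map (rn_metric 3) (conj_coords (spin \<theta>))"
    by (auto simp: isometric_self_map_def conj_coords_def mspace_eq_range_coords mdist_coords dist_spin)
  moreover have "conj_coords (spin \<theta>) (\<lambda>_. 0) = (\<lambda>_. 0)"
    by (simp add: conj_coords_def spin_def flip: coords_0)
  moreover have "banach_contraction (rn_metric 3) (f j)" if "j \<in> {1..3}" for j
    using that banach_contraction_conj_coords[OF _ lipschitz_shrink]
      banach_contraction_conj_coords[OF _ lipschitz_lift] banach_contraction_conj_coords[OF _ const]
    unfolding interval by (auto simp: f_def)
  ultimately have "R_IFS 3 1 R 3 f"
    by (simp add: R_IFS_def R_def)
  moreover have "R ` {1..1} \<union> f ` {1..3} = conj_coords ` {spin \<theta>, shrink, \<lambda>_. (0, 1), lift}"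
    unfolding interval by (auto simp: R_def f_def)
  then have "minimal_invariant_set (rn_metric 3) (R ` {1..1} \<union> f ` {1..3}) (coords ` rings)"
    using minimal_invariant_set_rings[OF \<theta>] by simp
  moreover have "(1::nat) \<le> 3"
    by simp
  ultimately show ?thesis
    using not_invariant_set_coords_rings by blast
qed

end
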